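(* Let $T>0$, $d_X,D\in\mathbb N_+$, and let $\mathfrak B\subseteq\mathcal H^2_T(\mathbb R^{d_X})$ be the class of generalized predictable Euler–Maruyama processes defined in the context. Then: (i) If $\mu_G$ is a centred Gaussian measure on $\mathcal H^2_T(\mathbb R^{d_X})$ whose covariance operator $Q$ is diagonal in some orthonormal basis $(\eta_n)_{n=1}^\infty$ of $\mathcal H^2_T(\mathbb R^{d_X})$ with strictly positive eigenvalues $(\lambda_n)_{n=1}^\infty$, then $\mu_G(\mathfrak B)=0$. (ii) $\mathfrak B$ is meagre in $\mathcal H^2_T(\mathbb R^{d_X})$.
   Context: $W$ is a $D$-dimensional Brownian motion on a complete probability space $(\Omega,\mathcal F,\mathbb P)$ and $(\mathcal F_t)_{0\le t\le T}$ is the usual $\mathbb P$-augmentation of its filtration. $\mathcal H^2_T(\mathbb R^{d_X})$ is the Hilbert space of $\mathbb R^{d_X}$-valued predictable processes $u$ with $\|u\|^2=\mathbb E\int_0^T|u_t|^2\,dt<\infty$. A set is meagre if it is contained in a countable union of nowhere dense sets. The class $\mathfrak B\subseteq\mathcal H^2_T(\mathbb R^{d_X})$ consists of all processes $X\in\mathcal H^2_T(\mathbb R^{d_X})$ for which there exist $X^{(0)}\in L^2(\mathcal F_0;\mathbb R^{d_X})$, $0<\delta<T$, and a Borel function $f:[0,\infty)\times\mathbb R^{d_X+2D}\to\mathbb R^{d_X}$ such that, with $N_\delta=\lceil T/\delta\rceil$ and $t_i=(i\delta)\wedge T$ for $i=0,\dots,N_\delta$, one has $\mathbb P$-a.s.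 for all $0\le t\le T$ $$X_t=\sum_{i=0}^{N_\delta-1}\mathbf 1_{[t_i,t_{i+1})}(t)\,\mathbb E\big[X^{(i)}\,\big|\,\mathcal F_{t_i}\big],\qquad X^{(i+1)}=f(t_i,X^{(i)},W_{t_i},W_{t_{i+1}})\quad(0\le i\le N_\delta-1).$$ *)

theory Defs
  imports "HOL-Probability.Probability"
begin

section \<open>The Hilbert space of square-integrable functions modulo null sets\<close>

definition L2_fun :: "'a measure \<Rightarrow> ('a \<Rightarrow> 'b::euclidean_space) set" where
  "L2_fun N = {f \<in> borel_measurable N. integrable N (\<lambda>x. (norm (f x))\<^sup>2)}"

definition L2_class :: "'a measure \<Rightarrow> ('a \<Rightarrow> 'b::euclidean_space) \<Rightarrow> ('a \<Rightarrow> 'b) set" where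
  "L2_class N f = {g \<in> L2_fun N. AE x in N. g x = f x}"

definition L2 :: "'a measure \<Rightarrow> ('a \<Rightarrow> 'b::euclidean_space) set set" where
  "L2 N = L2_class N ` L2_fun N"

definition rep :: "('a \<Rightarrow> 'b) set \<Rightarrow> 'a \<Rightarrow> 'b" where
  "rep U = (SOME u. u \<in> U)"

definition L2_scaleR :: "'a measure \<Rightarrow> real \<Rightarrow> ('a \<Rightarrow> 'b::euclidean_space) set \<Rightarrow> ('a \<Rightarrow> 'b) set" where
  "L2_scaleR N c U = L2_class N (\<lambda>x. c *\<^sub>R rep U x)"

definition L2_diff :: "'a measure \<Rightarrow> ('a \<Rightarrow> 'b::euclidean_space) set \<Rightarrow> ('a \<Rightarrow> 'b) set \<Rightarrow> ('a \<Rightarrow> 'b) set" where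
  "L2_diff N U V = L2_class N (\<lambda>x. rep U x - rep V x)"

definition L2_sum :: "'a measure \<Rightarrow> (nat \<Rightarrow> ('a \<Rightarrow> 'b::euclidean_space) set) \<Rightarrow> nat set \<Rightarrow> ('a \<Rightarrow> 'b) set" where
  "L2_sum N U I = L2_class N (\<lambda>x. \<Sum>i\<in>I. rep (U i) x)"

definition L2_inner :: "'a measure \<Rightarrow> ('a \<Rightarrow> 'b::euclidean_space) set \<Rightarrow> ('a \<Rightarrow> 'b) set \<Rightarrow> real" where
  "L2_inner N U V = (\<integral>x. rep U x \<bullet> rep V x \<partial>N)"

definition L2_norm :: "'a measure \<Rightarrow> ('a \<Rightarrow> 'b::euclidean_space) set \<Rightarrow> real" where
  "L2_norm N U = sqrt (L2_inner N U U)"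

definition L2_dist :: "'a measure \<Rightarrow> ('a \<Rightarrow> 'b::euclidean_space) set \<Rightarrow> ('a \<Rightarrow> 'b) set \<Rightarrow> real" where
  "L2_dist N U V = L2_norm N (L2_diff N U V)"

definition L2_topology :: "'a measure \<Rightarrow> ('a \<Rightarrow> 'b::euclidean_space) set topology" where
  "L2_topology N = Metric_space.mtopology (L2 N) (L2_dist N)"

definition L2_borel :: "'a measure \<Rightarrow> ('a \<Rightarrow> 'b::euclidean_space) set measure" where
  "L2_borel N = sigma (L2 N) {S. openin (L2_topology N) S}"

definition L2_orthonormal_basis :: "'a measure \<Rightarrow> (nat \<Rightarrow> ('a \<Rightarrow> 'b::euclidean_space) set) \<Rightarrow> bool" where
  "L2_orthonormal_basis N \<eta> \<longleftrightarrow>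
     (\<forall>n. \<eta> n \<in> L2 N) \<and>
     (\<forall>m n. L2_inner N (\<eta> m) (\<eta> n) = (if m = n then 1 else 0)) \<and>
     (\<forall>U\<in>L2 N. (\<lambda>n. L2_dist N U (L2_sum N (\<lambda>k. L2_scaleR N (L2_inner N U (\<eta> k)) (\<eta> k)) {..<n}))
        \<longlonglongrightarrow> 0)"


section \<open>Gaussian measures\<close>

text \<open>The second parameter is the standard deviation; the value \<open>0\<close> gives a Dirac measure.\<close>

definition normal_law :: "real \<Rightarrow> real \<Rightarrow> real measure" where
  "normal_law m \<sigma> = (if \<sigma> = 0 then return borel m else density lborel (normal_density m \<sigma>))"

definition L2_gaussian :: "'a measure \<Rightarrow> ('a \<Rightarrow> 'b::euclidean_space) set measure \<Rightarrow> bool" where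
  "L2_gaussian N \<mu> \<longleftrightarrow>
     prob_space \<mu> \<and> space \<mu> = L2 N \<and> sets \<mu> = sets (L2_borel N) \<and>
     (\<forall>U\<in>L2 N. \<exists>m \<sigma>. \<sigma> \<ge> 0 \<and> distr \<mu> borel (\<lambda>X. L2_inner N X U) = normal_law m \<sigma>)"

definition L2_centred :: "'a measure \<Rightarrow> ('a \<Rightarrow> 'b::euclidean_space) set measure \<Rightarrow> bool" where
  "L2_centred N \<mu> \<longleftrightarrow> (\<forall>U\<in>L2 N. (\<integral>X. L2_inner N X U \<partial>\<mu>) = 0)"

text \<open>Linearity and boundedness of \<open>Q\<close> need not be required: its values are determined by their
  inner products, and the right-hand side is a bounded bilinear form.\<close>

definition L2_covariance_operator ::
  "'a measure \<Rightarrow> ('a \<Rightarrow> 'b::euclidean_space) set measure \<Rightarrow> (('a \<Rightarrow> 'b) set \<Rightarrow> ('a \<Rightarrow> 'b) set) \<Rightarrow> bool" where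
  "L2_covariance_operator N \<mu> Q \<longleftrightarrow>
     Q \<in> L2 N \<rightarrow> L2 N \<and>
     (\<forall>U\<in>L2 N. \<forall>V\<in>L2 N. L2_inner N (Q U) V =
        (\<integral>X. (L2_inner N X U - (\<integral>Y. L2_inner N Y U \<partial>\<mu>)) *
              (L2_inner N X V - (\<integral>Y. L2_inner N Y V \<partial>\<mu>)) \<partial>\<mu>))"


section \<open>Meagre sets\<close>

definition nowhere_dense_in :: "'a topology \<Rightarrow> 'a set \<Rightarrow> bool" where
  "nowhere_dense_in X S \<longleftrightarrow> S \<subseteq> topspace X \<and> X interior_of (X closure_of S) = {}"

definition meagre_in :: "'a topology \<Rightarrow> 'a set \<Rightarrow> bool" where
  "meagre_in X S \<longleftrightarrow>
     (\<exists>\<C>. countable \<C> \<and> (\<forall>C\<in>\<C>. nowhere_dense_in X C) \<and> S \<subseteq> \<Union>\<C>)"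


section \<open>Brownian motion and its augmented filtration\<close>

definition natural_filtration :: "'w measure \<Rightarrow> (real \<Rightarrow> 'w \<Rightarrow> 'b::topological_space) \<Rightarrow> real \<Rightarrow> 'w measure" where
  "natural_filtration M W t =
     sigma (space M) (\<Union>r\<in>{0..t}. {W r -` A \<inter> space M | A. A \<in> sets borel})"

locale brownian_motion = prob_space M
  for M :: "'w measure" +
  fixes W :: "real \<Rightarrow> 'w \<Rightarrow> real ^ 'e"
  assumes measurable_W: "0 \<le> t \<Longrightarrow> W t \<in> borel_measurable M"
    and start_at_0: "AE \<omega> in M. W 0 \<omega> = 0"
    and continuous_paths: "AE \<omega> in M. continuous_on {0..} (\<lambda>t. W t \<omega>)"
    and increments_indep_past: "0 \<le> s \<Longrightarrow> s < t \<Longrightarrow>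
      indep_set (sets (natural_filtration M W s))
        {(\<lambda>\<omega>. W t \<omega> - W s \<omega>) -` A \<inter> space M | A. A \<in> sets borel}"
    and increments_indep_components: "0 \<le> s \<Longrightarrow> s < t \<Longrightarrow>
      indep_vars (\<lambda>_. borel) (\<lambda>j \<omega>. (W t \<omega> - W s \<omega>) $ j) UNIV"
    and increments_normal: "0 \<le> s \<Longrightarrow> s < t \<Longrightarrow>
      distributed M lborel (\<lambda>\<omega>. (W t \<omega> - W s \<omega>) $ j) (normal_density 0 (sqrt (t - s)))"

text \<open>Right-continuous version of the filtration completed by all null sets of \<open>M\<close>. The
  intersection of the \<open>\<sigma>\<close>-algebras is itself a \<open>\<sigma>\<close>-algebra; \<open>sigma\<close> only turns it into
  a \<open>measure\<close>.\<close>

definition usual_augmentation :: "'w measure \<Rightarrow> (real \<Rightarrow> 'w \<Rightarrow> 'b::topological_space) \<Rightarrow> real \<Rightarrow> 'w measure" where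
  "usual_augmentation M W t =
     sigma (space M) (\<Inter>s\<in>{t<..}. sigma_sets (space M) (sets (natural_filtration M W s) \<union> null_sets M))"


section \<open>Square-integrable predictable processes\<close>

text \<open>Processes are functions of the pair (time, outcome); only their values on
  \<open>{0..T} \<times> space M\<close> matter.\<close>

definition predictable_algebra :: "'w measure \<Rightarrow> (real \<Rightarrow> 'w measure) \<Rightarrow> real \<Rightarrow> (real \<times> 'w) measure" where
  "predictable_algebra M F T =
     sigma ({0..T} \<times> space M)
       ({{0} \<times> A | A. A \<in> sets (F 0)} \<union>
        {{s<..t} \<times> A | s t A. 0 \<le> s \<and> s < t \<and> t \<le> T \<and> A \<in> sets (F s)})"

definition predictable_measure :: "'w measure \<Rightarrow> (real \<Rightarrow> 'w \<Rightarrow> 'b::topological_space) \<Rightarrow> real \<Rightarrow> (real \<times> 'w) measure" where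
  "predictable_measure M W T =
     restr_to_subalg (restrict_space lborel {0..T} \<Otimes>\<^sub>M M)
       (predictable_algebra M (usual_augmentation M W) T)"

definition H2 :: "'w measure \<Rightarrow> (real \<Rightarrow> 'w \<Rightarrow> 'b::topological_space) \<Rightarrow> real \<Rightarrow>
    (real \<times> 'w \<Rightarrow> real ^ 'd) set set" where
  "H2 M W T = L2 (predictable_measure M W T)"


section \<open>Generalized predictable Euler--Maruyama processes\<close>

definition grid :: "real \<Rightarrow> real \<Rightarrow> nat \<Rightarrow> real" where
  "grid T \<delta> i = min (real i * \<delta>) T"

definition vec_cond_exp :: "'w measure \<Rightarrow> 'w measure \<Rightarrow> ('w \<Rightarrow> real ^ 'd) \<Rightarrow> 'w \<Rightarrow> real ^ 'd" where
  "vec_cond_exp M G X \<omega> = (\<chi> j. real_cond_exp M G (\<lambda>\<omega>. X \<omega> $ j) \<omega>)"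

primrec EM_step :: "(real \<times> (real ^ 'd) \<times> (real ^ 'e) \<times> (real ^ 'e) \<Rightarrow> real ^ 'd) \<Rightarrow>
    (real \<Rightarrow> 'w \<Rightarrow> real ^ 'e) \<Rightarrow> real \<Rightarrow> real \<Rightarrow> ('w \<Rightarrow> real ^ 'd) \<Rightarrow> nat \<Rightarrow> 'w \<Rightarrow> real ^ 'd" where
  "EM_step f W T \<delta> X0 0 = X0"
| "EM_step f W T \<delta> X0 (Suc i) =
     (\<lambda>\<omega>. f (grid T \<delta> i, EM_step f W T \<delta> X0 i \<omega>, W (grid T \<delta> i) \<omega>, W (grid T \<delta> (Suc i)) \<omega>))"

text \<open>An equivalence class belongs to the class of Euler--Maruyama processes iff one of its
  predictable representatives has the required form almost surely. No integrability is imposed on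
  the iterates \<open>EM_step\<close>: the \<open>i\<close>-th one is measurable with respect to the \<open>\<sigma>\<close>-algebra
  at time \<open>grid T \<delta> i\<close>, so it agrees almost surely with its conditional expectation
  \<open>real_cond_exp\<close> (which is taken separately on positive and negative parts) and is then square
  integrable because \<open>X\<close> is.\<close>

definition EM_processes :: "'w measure \<Rightarrow> (real \<Rightarrow> 'w \<Rightarrow> real ^ 'e) \<Rightarrow> real \<Rightarrow>
    (real \<times> 'w \<Rightarrow> real ^ 'd) set set" where
  "EM_processes M W T = {U \<in> H2 M W T. \<exists>X\<in>U. \<exists>X0 \<delta> f.
     X0 \<in> borel_measurable (usual_augmentation M W 0) \<and> integrable M (\<lambda>\<omega>. (norm (X0 \<omega>))\<^sup>2) \<and>
     0 < \<delta> \<and> \<delta> < T \<and>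
     f \<in> borel_measurable (restrict_space borel ({0..} \<times> UNIV)) \<and>
     (AE \<omega> in M. \<forall>t\<in>{0..T}. X (t, \<omega>) =
        (\<Sum>i<nat \<lceil>T / \<delta>\<rceil>. indicator {grid T \<delta> i..<grid T \<delta> (Suc i)} t *\<^sub>R
           vec_cond_exp M (usual_augmentation M W (grid T \<delta> i)) (EM_step f W T \<delta> X0 i) \<omega>))}"


section \<open>Well-definedness\<close>

lemma L2_fun_minus:
  assumes "f \<in> L2_fun N" "g \<in> L2_fun N"
  shows "(\<lambda>x. f x - g x) \<in> L2_fun N"
proof -
  have [measurable]: "f \<in> borel_measurable N" "g \<in> borel_measurable N"
    using assms by (auto simp: L2_fun_def)
  have i: "integrable N (\<lambda>x. 2 * (norm (f x))\<^sup>2 + 2 * (norm (g x))\<^sup>2)"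
    using assms by (auto simp: L2_fun_def)
  have "norm ((norm (f x - g x))\<^sup>2) \<le> norm (2 * (norm (f x))\<^sup>2 + 2 * (norm (g x))\<^sup>2)" for x
  proof -
    have "(norm (f x - g x))\<^sup>2 \<le> (norm (f x) + norm (g x))\<^sup>2"
      by (intro power_mono norm_triangle_ineq4) auto
    also have "\<dots> \<le> 2 * (norm (f x))\<^sup>2 + 2 * (norm (g x))\<^sup>2"
      using sum_squares_bound[of "norm (f x)" "norm (g x)"] by (simp add: power2_sum)
    finally show ?thesis by simp
  qed
  then have "integrable N (\<lambda>x. (norm (f x - g x))\<^sup>2)"
    by (intro Bochner_Integration.integrable_bound[OF i]) auto
  then show ?thesis by (simp add: L2_fun_def)
qed

lemma L2_fun_integrable_inner:
  assumes "f \<in> L2_fun N" "g \<in> L2_fun N"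
  shows "integrable N (\<lambda>x. f x \<bullet> g x)"
proof -
  have [measurable]: "f \<in> borel_measurable N" "g \<in> borel_measurable N"
    using assms by (auto simp: L2_fun_def)
  have i: "integrable N (\<lambda>x. (norm (f x))\<^sup>2 + (norm (g x))\<^sup>2)"
    using assms by (auto simp: L2_fun_def)
  have "norm (f x \<bullet> g x) \<le> norm ((norm (f x))\<^sup>2 + (norm (g x))\<^sup>2)" for x
  proof -
    have "\<bar>f x \<bullet> g x\<bar> \<le> norm (f x) * norm (g x)" by (rule Cauchy_Schwarz_ineq2)
    moreover have "0 \<le> norm (f x) * norm (g x)" by simp
    ultimately show ?thesis
      using sum_squares_bound[of "norm (f x)" "norm (g x)"]
      by (simp del: mult_nonneg_nonneg)
  qed
  then show ?thesis
    by (intro Bochner_Integration.integrable_bound[OF i]) auto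
qed

lemma L2_class_cong:
  assumes ae: "AE x in N. f x = h x"
  shows "L2_class N f = L2_class N h"
proof -
  have "(AE x in N. k x = f x) \<longleftrightarrow> (AE x in N. k x = h x)" for k
  proof
    assume "AE x in N. k x = f x"
    with ae show "AE x in N. k x = h x" by eventually_elim simp
  next
    assume "AE x in N. k x = h x"
    with ae show "AE x in N. k x = f x" by eventually_elim simp
  qed
  then show ?thesis by (simp add: L2_class_def)
qed

lemma rep_L2:
  assumes "U \<in> L2 N" shows "rep U \<in> U" "rep U \<in> L2_fun N" "U = L2_class N (rep U)"
proof -
  obtain f where f: "f \<in> L2_fun N" "U = L2_class N f" using assms by (auto simp: L2_def)
  then have "f \<in> U" by (simp add: L2_class_def)
  then show r: "rep U \<in> U" unfolding rep_def by (rule someI[where P = "\<lambda>u. u \<in> U"])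
  then show "rep U \<in> L2_fun N" using f by (simp add: L2_class_def)
  have "AE x in N. f x = rep U x" using r f by (auto simp: L2_class_def)
  then show "U = L2_class N (rep U)" unfolding f(2) by (rule L2_class_cong)
qed

lemma rep_L2_class:
  assumes "f \<in> L2_fun N" shows "AE x in N. rep (L2_class N f) x = f x"
  using rep_L2(1)[of "L2_class N f" N] assms by (auto simp: L2_def L2_class_def)

lemma L2_inner_class:
  assumes f: "f \<in> L2_fun N" and g: "g \<in> L2_fun N"
  shows "L2_inner N (L2_class N f) (L2_class N g) = (\<integral>x. f x \<bullet> g x \<partial>N)"
proof -
  have "rep (L2_class N f) \<in> L2_fun N" "rep (L2_class N g) \<in> L2_fun N"
    using rep_L2(2) f g by (auto simp: L2_def)
  then have "integrable N (\<lambda>x. rep (L2_class N f) x \<bullet> rep (L2_class N g) x)"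
    "integrable N (\<lambda>x. f x \<bullet> g x)"
    using L2_fun_integrable_inner f g by blast+
  then show ?thesis unfolding L2_inner_def
    by (intro integral_cong_AE borel_measurable_integrable)
       (use rep_L2_class[OF f] rep_L2_class[OF g] in \<open>auto elim: eventually_elim2\<close>)
qed

lemma L2_dist_rep:
  assumes "U \<in> L2 N" "V \<in> L2 N"
  shows "L2_dist N U V = sqrt (\<integral>x. (norm (rep U x - rep V x))\<^sup>2 \<partial>N)"
proof -
  have "(\<lambda>x. rep U x - rep V x) \<in> L2_fun N" using L2_fun_minus rep_L2(2) assms by blast
  then show ?thesis
    by (simp add: L2_dist_def L2_norm_def L2_diff_def L2_inner_class dot_square_norm)
qed

lemma L2_minkowski:
  assumes f: "f \<in> L2_fun N" and g: "g \<in> L2_fun N"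
  shows "sqrt (\<integral>x. (norm (f x - g x))\<^sup>2 \<partial>N)
    \<le> sqrt (\<integral>x. (norm (f x))\<^sup>2 \<partial>N) + sqrt (\<integral>x. (norm (g x))\<^sup>2 \<partial>N)"
proof -
  define a where "a = (\<integral>x. (norm (f x))\<^sup>2 \<partial>N)"
  define b where "b = (\<integral>x. (norm (g x))\<^sup>2 \<partial>N)"
  define c where "c = (\<integral>x. f x \<bullet> g x \<partial>N)"
  have fi: "integrable N (\<lambda>x. (norm (f x))\<^sup>2)" and gi: "integrable N (\<lambda>x. (norm (g x))\<^sup>2)"
    using f g by (auto simp: L2_fun_def)
  note fgi = L2_fun_integrable_inner[OF f g]
  have ex: "(\<integral>x. (norm (s *\<^sub>R f x - t *\<^sub>R g x))\<^sup>2 \<partial>N) = s\<^sup>2 * a - 2 * s * t * c + t\<^sup>2 * b" for s t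
  proof -
    have *: "(norm (s *\<^sub>R f x - t *\<^sub>R g x))\<^sup>2 =
        s\<^sup>2 * (norm (f x))\<^sup>2 - 2 * s * t * (f x \<bullet> g x) + t\<^sup>2 * (norm (g x))\<^sup>2" for x
      unfolding power2_norm_eq_inner
      by (simp add: inner_diff inner_commute algebra_simps power2_eq_square)
    show ?thesis unfolding * a_def b_def c_def using fi gi fgi by simp
  qed
  have a0: "a \<ge> 0" and b0: "b \<ge> 0" by (simp_all add: a_def b_def)
  have q: "s\<^sup>2 * a - 2 * s * t * c + t\<^sup>2 * b \<ge> 0" for s t unfolding ex[symmetric] by simp
  have "c\<^sup>2 \<le> a * b"
  proof (cases "a = 0")
    case True
    have "2 * s * c \<le> b" for s using q[of s 1] True by simp
    from this[of "(b + 1) / (2 * c)"] have "c = 0" by (auto split: if_splits)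
    then show ?thesis using True by simp
  next
    case False
    have "a * (a * b - c\<^sup>2) \<ge> 0" using q[of c a] by (simp add: power2_eq_square algebra_simps)
    then show ?thesis using False a0 by (simp add: zero_le_mult_iff)
  qed
  then have "\<bar>c\<bar> \<le> sqrt a * sqrt b"
    by (metis real_sqrt_abs real_sqrt_le_iff real_sqrt_mult)
  then have "a - 2 * c + b \<le> (sqrt a + sqrt b)\<^sup>2"
    using a0 b0 by (simp add: power2_sum)
  then have "sqrt (a - 2 * c + b) \<le> sqrt a + sqrt b"
    using a0 b0 by (intro real_le_lsqrt) auto
  moreover have "(\<integral>x. (norm (f x - g x))\<^sup>2 \<partial>N) = a - 2 * c + b" using ex[of 1 1] by simp
  ultimately show ?thesis by (simp add: a_def b_def)
qed

lemma Metric_space_L2: "Metric_space (L2 N) (L2_dist N)"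
proof
  fix U V :: "('a \<Rightarrow> 'b) set"
  show "0 \<le> L2_dist N U V"
    unfolding L2_dist_def L2_norm_def L2_inner_def by simp
  have neg: "- g \<in> L2_fun N" if "g \<in> L2_fun N" for g :: "'a \<Rightarrow> 'b"
    using that by (auto simp: L2_fun_def fun_Compl_def)
  show "L2_dist N U V = L2_dist N V U"
  proof (cases "\<exists>g\<in>L2_fun N. AE x in N. g x = rep U x - rep V x")
    case True
    then obtain g where g: "g \<in> L2_fun N" "AE x in N. g x = rep U x - rep V x" by blast
    have "L2_diff N U V = L2_class N g"
      unfolding L2_diff_def by (rule L2_class_cong) (use g(2) in \<open>eventually_elim, simp\<close>)
    moreover have "L2_diff N V U = L2_class N (- g)"
      unfolding L2_diff_def by (rule L2_class_cong) (use g(2) in \<open>eventually_elim, simp\<close>)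
    ultimately show ?thesis using g(1) neg[OF g(1)]
      by (simp add: L2_dist_def L2_norm_def L2_inner_class)
  next
    case False
    have "\<not> (AE x in N. g x = rep V x - rep U x)" if "g \<in> L2_fun N" for g
    proof
      assume "AE x in N. g x = rep V x - rep U x"
      then have "AE x in N. (- g) x = rep U x - rep V x" by eventually_elim simp
      then show False using False neg[OF that] by blast
    qed
    with False have "L2_diff N U V = {}" "L2_diff N V U = {}"
      by (auto simp: L2_diff_def L2_class_def)
    then show ?thesis by (simp add: L2_dist_def)
  qed
next
  fix U V :: "('a \<Rightarrow> 'b) set" assume UV: "U \<in> L2 N" "V \<in> L2 N"
  have d: "(\<lambda>x. rep U x - rep V x) \<in> L2_fun N" using L2_fun_minus rep_L2(2) UV by blast
  have "L2_dist N U V = 0 \<longleftrightarrow> (AE x in N. (norm (rep U x - rep V x))\<^sup>2 = 0)"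
    unfolding L2_dist_rep[OF UV] real_sqrt_eq_0_iff
    using d by (intro integral_nonneg_eq_0_iff_AE) (auto simp: L2_fun_def)
  also have "\<dots> \<longleftrightarrow> (AE x in N. rep U x = rep V x)" by simp
  also have "\<dots> \<longleftrightarrow> U = V"
  proof
    assume ae: "AE x in N. rep U x = rep V x"
    then have "L2_class N (rep U) = L2_class N (rep V)" by (rule L2_class_cong)
    then show "U = V" using rep_L2(3)[OF UV(1)] rep_L2(3)[OF UV(2)] by simp
  qed simp
  finally show "L2_dist N U V = 0 \<longleftrightarrow> U = V" .
next
  fix U V Y :: "('a \<Rightarrow> 'b) set" assume UVY: "U \<in> L2 N" "V \<in> L2 N" "Y \<in> L2 N"
  have "(\<lambda>x. rep U x - rep V x) \<in> L2_fun N" "(\<lambda>x. rep Y x - rep V x) \<in> L2_fun N"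
    using L2_fun_minus rep_L2(2) UVY by blast+
  from L2_minkowski[OF this]
  show "L2_dist N U Y \<le> L2_dist N U V + L2_dist N V Y"
    using UVY by (simp add: L2_dist_rep norm_minus_commute)
qed

lemma sets_predictable_algebra_le:
  assumes "brownian_motion M W" "0 < T"
  shows "subalgebra (restrict_space lborel {0..T} \<Otimes>\<^sub>M M)
    (predictable_algebra M (usual_augmentation M W) T)"
proof -
  interpret brownian_motion M W by fact
  have nat: "sets (natural_filtration M W s) \<subseteq> sets M" for s
    unfolding natural_filtration_def
    by (subst sets_measure_of) (auto intro!: sets.sigma_sets_subset measurable_sets measurable_W)
  have aug: "sets (usual_augmentation M W s) \<subseteq> sets M" for s
  proof -
    have "sigma_sets (space M) (sets (natural_filtration M W (s + 1)) \<union> null_sets M) \<subseteq> sets M"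
      using nat by (intro sets.sigma_sets_subset) auto
    moreover have "s + 1 \<in> {s<..}" by simp
    ultimately have *: "(\<Inter>u\<in>{s<..}. sigma_sets (space M) (sets (natural_filtration M W u) \<union> null_sets M))
        \<subseteq> sets M" by blast
    then show ?thesis unfolding usual_augmentation_def
      by (subst sets_measure_of) (auto intro!: sets.sigma_sets_subset dest: sets.sets_into_space)
  qed
  have "A \<in> sets M \<Longrightarrow> {s<..t} \<times> A \<in> sets (restrict_space lborel {0..T} \<Otimes>\<^sub>M M)"
    if "0 \<le> s" "t \<le> T" for A s t
    using that by (intro pair_measureI) (auto simp: sets_restrict_space_iff)
  moreover have "A \<in> sets M \<Longrightarrow> {0} \<times> A \<in> sets (restrict_space lborel {0..T} \<Otimes>\<^sub>M M)" for A
    using assms(2) by (intro pair_measureI) (auto simp: sets_restrict_space_iff)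
  moreover have sp: "space (restrict_space lborel {0..T} \<Otimes>\<^sub>M M) = {0..T} \<times> space M"
    by (simp add: space_pair_measure space_restrict_space)
  ultimately have "sigma_sets ({0..T} \<times> space M)
       ({{0} \<times> A | A. A \<in> sets (usual_augmentation M W 0)} \<union>
        {{s<..t} \<times> A | s t A. 0 \<le> s \<and> s < t \<and> t \<le> T \<and> A \<in> sets (usual_augmentation M W s)})
     \<subseteq> sets (restrict_space lborel {0..T} \<Otimes>\<^sub>M M)" (is "sigma_sets _ ?G \<subseteq> _")
    unfolding sp[symmetric] using aug by (intro sets.sigma_sets_subset) blast
  moreover have "?G \<subseteq> Pow ({0..T} \<times> space M)"
    using aug sets.sets_into_space[of _ M] assms(2) by fastforce
  ultimately show ?thesis
    unfolding subalgebra_def predictable_algebra_def sp by (simp add: sets_measure_of)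
qed

text \<open>The norm of \<open>H2\<close> is the one given by the expectation of the time integral.\<close>

lemma L2_norm_H2:
  fixes U :: "(real \<times> 'w \<Rightarrow> real ^ 'd) set"
  assumes "brownian_motion M W" "0 < T" "U \<in> H2 M W T" "X \<in> U"
  shows "(L2_norm (predictable_measure M W T) U)\<^sup>2 = (\<integral>\<omega>. (LBINT t:{0..T}. (norm (X (t, \<omega>)))\<^sup>2) \<partial>M)"
proof -
  interpret brownian_motion M W by fact
  interpret L: sigma_finite_measure "restrict_space lborel {0..T}"
    by (rule sigma_finite_measure_restrict_space[OF lborel.sigma_finite_measure_axioms]) auto
  interpret P: pair_sigma_finite "restrict_space lborel {0..T}" M by standard
  let ?P = "restrict_space lborel {0..T} \<Otimes>\<^sub>M M"
  let ?G = "predictable_algebra M (usual_augmentation M W) T"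
  let ?N = "predictable_measure M W T"
  note sub = sets_predictable_algebra_le[OF assms(1,2)]
  obtain f where f: "f \<in> L2_fun ?N" "U = L2_class ?N f"
    using assms(3) by (auto simp: H2_def L2_def)
  have X: "X \<in> L2_fun ?N" "AE z in ?N. X z = f z" using assms(4) f by (auto simp: L2_class_def)
  have "U = L2_class ?N X"
    unfolding f(2) by (rule L2_class_cong) (use X(2) in \<open>eventually_elim, simp\<close>)
  then have "(L2_norm ?N U)\<^sup>2 = (\<integral>z. (norm (X z))\<^sup>2 \<partial>?N)"
    using X(1) by (simp add: L2_norm_def L2_inner_class dot_square_norm)
  also have "\<dots> = (\<integral>z. (norm (X z))\<^sup>2 \<partial>?P)"
    unfolding predictable_measure_def
  proof (rule integral_subalgebra2[OF sub])
    have "X \<in> borel_measurable ?G"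
      using X(1) measurable_in_subalg'[OF sub] by (auto simp: L2_fun_def predictable_measure_def)
    then show "(\<lambda>z. (norm (X z))\<^sup>2) \<in> borel_measurable ?G" by measurable
  qed
  also have "\<dots> = (\<integral>\<omega>. (\<integral>t. (norm (X (t, \<omega>)))\<^sup>2 \<partial>restrict_space lborel {0..T}) \<partial>M)"
  proof -
    have "integrable ?P (\<lambda>z. (norm (X z))\<^sup>2)"
      using X(1) integrable_from_subalg[OF sub] by (auto simp: L2_fun_def predictable_measure_def)
    then show ?thesis using P.integral_snd[of "\<lambda>t \<omega>. (norm (X (t, \<omega>)))\<^sup>2"] by (simp add: case_prod_unfold)
  qed
  also have "\<dots> = (\<integral>\<omega>. (LBINT t:{0..T}. (norm (X (t, \<omega>)))\<^sup>2) \<partial>M)"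
    by (simp add: set_lebesgue_integral_def integral_restrict_space)
  finally show ?thesis .
qed

end

theory Submission
  imports Defs
begin

text \<open>A process of the class is constant in time on some interval \<open>[0, \<delta>)\<close>. It is therefore orthogonal
  to the deterministic process that equals \<open>1\<close> on \<open>(0, a/2]\<close>, \<open>-1\<close> on \<open>(a/2, a]\<close> and \<open>0\<close> afterwards,
  as soon as \<open>a < \<delta>\<close>. Letting \<open>a\<close> run through a null sequence, the class is covered by countably many
  closed hyperplanes. Each of them is nowhere dense, and each is a null set of a Gaussian measure
  whose covariance operator is injective.\<close>

section \<open>Linear structure and Cauchy-Schwarz for square-integrable functions\<close>

lemma L2_fun_add:
  assumes "f \<in> L2_fun N" "g \<in> L2_fun N"
  shows "(\<lambda>x. f x + g x) \<in> L2_fun N"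
proof -
  have "(\<lambda>x. 0 - g x) \<in> L2_fun N"
    by (rule L2_fun_minus) (use assms in \<open>auto simp: L2_fun_def\<close>)
  from L2_fun_minus[OF assms(1) this] show ?thesis by simp
qed

lemma L2_fun_scaleR:
  assumes "f \<in> L2_fun N"
  shows "(\<lambda>x. c *\<^sub>R f x) \<in> L2_fun N"
  using assms by (auto simp: L2_fun_def power_mult_distrib)

text \<open>Squaring the Minkowski bound for \<open>f - h\<close> and expanding both sides cancels
  the two square norms and leaves \<open>- 2 * (\<integral>x. f x \<bullet> h x \<partial>N) \<le> 2
  * (sqrt a * sqrt b)\<close>.\<close>

lemma L2_fun_Cauchy_Schwarz:
  assumes f: "f \<in> L2_fun N" and g: "g \<in> L2_fun N"
  shows "\<bar>\<integral>x. f x \<bullet> g x \<partial>N\<bar>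
    \<le> sqrt (\<integral>x. (norm (f x))\<^sup>2 \<partial>N) * sqrt (\<integral>x. (norm (g x))\<^sup>2 \<partial>N)"
proof -
  define a where "a = (\<integral>x. (norm (f x))\<^sup>2 \<partial>N)"
  define b where "b = (\<integral>x. (norm (g x))\<^sup>2 \<partial>N)"
  have a0: "a \<ge> 0" and b0: "b \<ge> 0" by (simp_all add: a_def b_def)
  \<comment> \<open>Stated for any \<open>h\<close> with the same norm as \<open>g\<close>, so that
    \<open>h = g\<close> and \<open>h = - g\<close> yield the two signs of the absolute
    value.\<close>
  have *: "- (\<integral>x. f x \<bullet> h x \<partial>N) \<le> sqrt a * sqrt b"
    if h: "h \<in> L2_fun N" and b: "(\<integral>x. (norm (h x))\<^sup>2 \<partial>N) = b" for h
  proof -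
    have i: "integrable N (\<lambda>x. (norm (f x))\<^sup>2)" "integrable N (\<lambda>x. (norm (h x))\<^sup>2)"
      "integrable N (\<lambda>x. f x \<bullet> h x)"
      using f h L2_fun_integrable_inner[OF f h] by (auto simp: L2_fun_def)
    have n: "(norm (f x - h x))\<^sup>2 = (norm (f x))\<^sup>2 - 2 * (f x \<bullet> h x) + (norm (h x))\<^sup>2" for x
      unfolding power2_norm_eq_inner by (simp add: inner_diff inner_commute algebra_simps)
    have "a - 2 * (\<integral>x. f x \<bullet> h x \<partial>N) + b = (\<integral>x. (norm (f x - h x))\<^sup>2 \<partial>N)"
      unfolding n a_def b[symmetric] using i by simp
    also have "\<dots> = (sqrt (\<integral>x. (norm (f x - h x))\<^sup>2 \<partial>N))\<^sup>2"
      by simp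
    also have "\<dots> \<le> (sqrt a + sqrt b)\<^sup>2"
      using L2_minkowski[OF f h] by (intro power_mono) (auto simp: a_def b)
    also have "\<dots> = a + b + 2 * (sqrt a * sqrt b)"
      using a0 b0 by (simp add: power2_sum)
    finally show ?thesis by simp
  qed
  have "(\<lambda>x. - g x) \<in> L2_fun N" using L2_fun_scaleR[OF g, of "-1"] by simp
  from *[OF this] *[OF g] show ?thesis by (simp add: a_def b_def)
qed

lemma L2_norm_rep: "L2_norm N U = sqrt (\<integral>x. (norm (rep U x))\<^sup>2 \<partial>N)"
  by (simp add: L2_norm_def L2_inner_def dot_square_norm)

lemma L2_norm_nonneg: "0 \<le> L2_norm N U"
  by (simp add: L2_norm_rep)

lemma L2_inner_commute: "L2_inner N U V = L2_inner N V U"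
  by (simp add: L2_inner_def inner_commute)

text \<open>Cauchy-Schwarz for the difference of the representatives. The resulting Lipschitz bound
  makes \<open>X \<mapsto> L2_inner N X V\<close> continuous.\<close>

lemma L2_inner_diff_le:
  assumes "X \<in> L2 N" "Y \<in> L2 N" "V \<in> L2 N"
  shows "\<bar>L2_inner N X V - L2_inner N Y V\<bar> \<le> L2_dist N X Y * L2_norm N V"
proof -
  note r = rep_L2(2)[OF assms(1)] rep_L2(2)[OF assms(2)] rep_L2(2)[OF assms(3)]
  have "L2_inner N X V - L2_inner N Y V = (\<integral>x. (rep X x - rep Y x) \<bullet> rep V x \<partial>N)"
    using L2_fun_integrable_inner[OF r(1,3)] L2_fun_integrable_inner[OF r(2,3)]
    by (simp add: L2_inner_def inner_diff_left)
  then show ?thesis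
    using L2_fun_Cauchy_Schwarz[OF L2_fun_minus[OF r(1,2)] r(3)]
    by (simp add: L2_dist_rep[OF assms(1,2)] L2_norm_rep)
qed

section \<open>Topology of \<open>L2\<close>: continuous functionals and nowhere dense
  hyperplanes\<close>

lemma topspace_L2_topology: "topspace (L2_topology N) = L2 N"
  unfolding L2_topology_def using Metric_space.topspace_mtopology[OF Metric_space_L2] .

lemma openin_L2_topology:
  "openin (L2_topology N) S \<longleftrightarrow>
    S \<subseteq> L2 N \<and> (\<forall>X\<in>S. \<exists>r>0. \<forall>Y\<in>L2 N. L2_dist N X Y < r \<longrightarrow> Y \<in> S)"
proof -
  have "Metric_space.mball (L2 N) (L2_dist N) X r \<subseteq> S \<longleftrightarrow>
      (\<forall>Y\<in>L2 N. L2_dist N X Y < r \<longrightarrow> Y \<in> S)" if "X \<in> L2 N" for X r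
    using that by (auto simp: Metric_space.in_mball[OF Metric_space_L2])
  then show ?thesis
    unfolding L2_topology_def Metric_space.openin_mtopology[OF Metric_space_L2]
    by (meson subsetD)
qed

lemma continuous_map_L2_inner:
  assumes V: "V \<in> L2 N"
  shows "continuous_map (L2_topology N) euclidean (\<lambda>X. L2_inner N X V)"
proof -
  have "openin (L2_topology N) {X \<in> L2 N. L2_inner N X V \<in> S}" if "open S" for S
    unfolding openin_L2_topology
  proof (intro conjI ballI)
    fix X assume "X \<in> {X \<in> L2 N. L2_inner N X V \<in> S}"
    then have X: "X \<in> L2 N" "L2_inner N X V \<in> S" by auto
    then obtain e where e: "e > 0" "ball (L2_inner N X V) e \<subseteq> S"
      using \<open>open S\<close> openE by blast
    \<comment> \<open>The summand 1 keeps the radius \<open>e / (L2_norm N V + 1)\<close> meaningful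
      when \<open>V\<close> has norm zero.\<close>
    have n: "0 < L2_norm N V + 1" using L2_norm_nonneg[of N V] by simp
    show "\<exists>r>0. \<forall>Y\<in>L2 N. L2_dist N X Y < r \<longrightarrow> Y \<in> {X \<in> L2 N. L2_inner N X V \<in> S}"
    proof (intro exI[of _ "e / (L2_norm N V + 1)"] conjI ballI impI)
      fix Y assume Y: "Y \<in> L2 N" "L2_dist N X Y < e / (L2_norm N V + 1)"
      have "\<bar>L2_inner N X V - L2_inner N Y V\<bar> \<le> L2_dist N X Y * L2_norm N V"
        by (rule L2_inner_diff_le) fact+
      also have "\<dots> \<le> L2_dist N X Y * (L2_norm N V + 1)"
        by (intro mult_left_mono) (auto simp: L2_dist_def L2_norm_nonneg)
      also have "\<dots> < e" using Y(2) n by (simp add: pos_less_divide_eq)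
      finally show "Y \<in> {X \<in> L2 N. L2_inner N X V \<in> S}"
        using e Y(1) by (auto simp: dist_real_def subset_iff)
    qed (use e n in auto)
  qed auto
  then show ?thesis by (auto simp: continuous_map_def topspace_L2_topology)
qed

text \<open>Continuity makes the hyperplane closed, so it suffices that it contains no nonempty open
  set. From any point of such a set a small step in the direction \<open>U\<close> stays in the set
  but changes the inner product with \<open>U\<close>.\<close>

lemma nowhere_dense_hyperplane:
  assumes U: "U \<in> L2 N" and U0: "L2_inner N U U \<noteq> 0"
  shows "nowhere_dense_in (L2_topology N) {X \<in> L2 N. L2_inner N X U = 0}" (is "nowhere_dense_in _ ?H")
proof -
  have "closedin (L2_topology N) {X \<in> topspace (L2_topology N). L2_inner N X U \<in> {0}}"
    by (rule closedin_continuous_map_preimage[OF continuous_map_L2_inner[OF U]]) simp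
  then have cl: "closedin (L2_topology N) ?H" by (simp add: topspace_L2_topology)
  have "S = {}" if S: "openin (L2_topology N) S" "S \<subseteq> ?H" for S
  proof (rule ccontr)
    assume "S \<noteq> {}"
    then obtain X where XS: "X \<in> S" by blast
    then have X: "X \<in> L2 N" "L2_inner N X U = 0" using S by auto
    obtain r where r: "r > 0" "\<And>Y. Y \<in> L2 N \<Longrightarrow> L2_dist N X Y < r \<Longrightarrow> Y \<in> S"
      using S(1) XS unfolding openin_L2_topology by blast
    have n: "0 < L2_norm N U + 1" using L2_norm_nonneg[of N U] by simp
    \<comment> \<open>This step length makes the distance from \<open>X\<close> to
      \<open>X + c U\<close>, namely \<open>c * L2_norm N U\<close>, strictly smaller than
      \<open>r\<close>.\<close>
    define c where "c = r / (L2_norm N U + 1)"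
    have c: "c > 0" using r n by (simp add: c_def)
    note rX = rep_L2[OF X(1)] and rU = rep_L2[OF U]
    define y where "y = (\<lambda>x. rep X x + c *\<^sub>R rep U x)"
    have y: "y \<in> L2_fun N" unfolding y_def by (intro L2_fun_add L2_fun_scaleR rX(2) rU(2))
    define Y where "Y = L2_class N y"
    have Y: "Y \<in> L2 N" using y by (auto simp: Y_def L2_def)
    have "L2_dist N X Y = c * L2_norm N U"
    proof -
      have "L2_diff N X Y = L2_class N (\<lambda>x. (- c) *\<^sub>R rep U x)"
        unfolding L2_diff_def
        by (rule L2_class_cong) (use rep_L2_class[OF y] in \<open>eventually_elim, simp add: Y_def y_def\<close>)
      moreover have "(\<lambda>x. (- c) *\<^sub>R rep U x) \<in> L2_fun N" by (intro L2_fun_scaleR rU(2))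
      ultimately have "L2_dist N X Y = sqrt (c\<^sup>2 * (\<integral>x. rep U x \<bullet> rep U x \<partial>N))"
        by (simp add: L2_dist_def L2_norm_def L2_inner_class power2_eq_square mult.assoc)
      then show ?thesis using c by (simp add: L2_norm_def L2_inner_def real_sqrt_mult)
    qed
    also have "\<dots> < c * (L2_norm N U + 1)" using c by simp
    also have "\<dots> = r" using n by (simp add: c_def)
    finally have "Y \<in> ?H" using r(2)[OF Y] S(2) by blast
    moreover have "L2_inner N Y U = L2_inner N X U + c * L2_inner N U U"
    proof -
      have "L2_inner N Y U = (\<integral>x. y x \<bullet> rep U x \<partial>N)"
        using L2_inner_class[OF y rU(2)] rU(3)[symmetric] by (simp add: Y_def)
      also have "\<dots> = (\<integral>x. rep X x \<bullet> rep U x + c * (rep U x \<bullet> rep U x) \<partial>N)"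
        by (simp add: y_def inner_add_left)
      also have "\<dots> = L2_inner N X U + c * L2_inner N U U"
        using L2_fun_integrable_inner[OF rX(2) rU(2)] L2_fun_integrable_inner[OF rU(2) rU(2)]
        by (simp add: L2_inner_def)
      finally show ?thesis .
    qed
    ultimately show False using X(2) c U0 by simp
  qed
  then have "L2_topology N interior_of ?H = {}"
    using openin_interior_of[of "L2_topology N" ?H] interior_of_subset[of "L2_topology N" ?H] by simp
  then show ?thesis
    using cl by (auto simp: nowhere_dense_in_def topspace_L2_topology closure_of_closedin)
qed

section \<open>Gaussian measure of hyperplanes\<close>

lemma L2_inner_borel_measurable:
  fixes V :: "('a \<Rightarrow> 'b::euclidean_space) set"
  assumes "V \<in> L2 N" and sp: "space \<mu> = L2 N" and se: "sets \<mu> = sets (L2_borel N)"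
  shows "(\<lambda>X. L2_inner N X V) \<in> borel_measurable \<mu>"
proof (rule borel_measurableI)
  fix S :: "real set" assume "open S"
  then have "openin (L2_topology N) {X \<in> topspace (L2_topology N). L2_inner N X V \<in> S}"
    by (intro openin_continuous_map_preimage[OF continuous_map_L2_inner[OF assms(1)]]) simp
  moreover have "sets (L2_borel N) = sigma_sets (L2 N) {S :: ('a \<Rightarrow> 'b) set set. openin (L2_topology N) S}"
    unfolding L2_borel_def
    by (rule sets_measure_of) (use openin_subset topspace_L2_topology in blast)
  ultimately have "{X \<in> L2 N. L2_inner N X V \<in> S} \<in> sets \<mu>"
    unfolding se topspace_L2_topology by (simp add: sigma_sets.Basic)
  then show "(\<lambda>X. L2_inner N X V) -` S \<inter> space \<mu> \<in> sets \<mu>"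
    by (simp add: sp vimage_def Int_def conj_commute)
qed

text \<open>All partial sums of the expansion of \<open>U\<close> are the zero class, so the
  distances to \<open>U\<close> form a constant sequence, whose limit 0 must be its value.\<close>

lemma L2_eq_zero_if_orthogonal_basis:
  fixes N :: "'a measure" and U :: "('a \<Rightarrow> 'b::euclidean_space) set"
  assumes b: "L2_orthonormal_basis N \<eta>" and U: "U \<in> L2 N"
    and orth: "\<And>n. L2_inner N U (\<eta> n) = 0"
  shows "L2_inner N U U = 0"
proof -
  have z: "(\<lambda>x. 0 :: 'b) \<in> L2_fun N" by (simp add: L2_fun_def)
  have "L2_scaleR N (L2_inner N U (\<eta> k)) (\<eta> k) = L2_class N (\<lambda>x. 0)" for k
    by (simp add: L2_scaleR_def orth)
  moreover have "L2_sum N (\<lambda>k. L2_class N (\<lambda>x. 0)) {..<n} = L2_class N (\<lambda>x. 0 :: 'b)" for n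
    unfolding L2_sum_def by (rule L2_class_cong) (use rep_L2_class[OF z] in \<open>eventually_elim, simp\<close>)
  ultimately have "(\<lambda>n :: nat. L2_dist N U (L2_class N (\<lambda>x. 0))) \<longlonglongrightarrow> 0"
    using b U unfolding L2_orthonormal_basis_def by auto
  then have "L2_dist N U (L2_class N (\<lambda>x. 0)) = 0"
    by (simp add: LIMSEQ_const_iff)
  moreover have "L2_diff N U (L2_class N (\<lambda>x. 0)) = L2_class N (rep U)"
    unfolding L2_diff_def by (rule L2_class_cong) (use rep_L2_class[OF z] in \<open>eventually_elim, simp\<close>)
  ultimately show ?thesis
    using rep_L2(3)[OF U, symmetric] by (simp add: L2_dist_def L2_norm_def)
qed

text \<open>The hyperplane is the event that the functional given by \<open>U\<close> takes the
  value 0. Strict positivity of the eigenvalues excludes a degenerate law of this functional, so the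
  law has a Lebesgue density and gives no mass to a point.\<close>

lemma L2_gaussian_hyperplane_null:
  assumes g: "L2_gaussian N \<mu>" and Q: "L2_covariance_operator N \<mu> Q"
    and b: "L2_orthonormal_basis N \<eta>" and pos: "\<And>n. 0 < l n"
    and eig: "\<And>n. Q (\<eta> n) = L2_scaleR N (l n) (\<eta> n)"
    and U: "U \<in> L2 N" and U0: "L2_inner N U U \<noteq> 0"
  shows "{X \<in> L2 N. L2_inner N X U = 0} \<in> null_sets \<mu>"
proof -
  interpret prob_space \<mu> using g by (simp add: L2_gaussian_def)
  have sp: "space \<mu> = L2 N" and se: "sets \<mu> = sets (L2_borel N)"
    using g by (auto simp: L2_gaussian_def)
  note meas[measurable] = L2_inner_borel_measurable[OF U sp se]
  obtain m \<sigma> where ms: "\<sigma> \<ge> 0" "distr \<mu> borel (\<lambda>X. L2_inner N X U) = normal_law m \<sigma>"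
    using g U by (auto simp: L2_gaussian_def)
  \<comment> \<open>If the functional were almost surely constant, its covariance with the
    functional of each \<open>\<eta> n\<close> would vanish. That covariance is
    \<open>l n * L2_inner N (\<eta> n) U\<close>, so \<open>U\<close> would be orthogonal to the
    whole basis.\<close>
  have "\<sigma> \<noteq> 0"
  proof
    assume "\<sigma> = 0"
    then have d: "distr \<mu> borel (\<lambda>X. L2_inner N X U) = return borel m"
      using ms by (simp add: normal_law_def)
    have "AE x in distr \<mu> borel (\<lambda>X. L2_inner N X U). x = m"
      unfolding d by (simp add: AE_return)
    then have ae: "AE X in \<mu>. L2_inner N X U = m"
      by (subst (asm) AE_distr_iff) auto
    \<comment> \<open>The constant value has to be identified with the mean, because the covariance
      is written with centred factors.\<close>
    then have "(\<integral>X. L2_inner N X U \<partial>\<mu>) = (\<integral>X. m \<partial>\<mu>)"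
      by (intro integral_cong_AE) auto
    then have mean: "(\<integral>X. L2_inner N X U \<partial>\<mu>) = m" by (simp add: prob_space)
    have "L2_inner N U (\<eta> n) = 0" for n
    proof -
      have e: "\<eta> n \<in> L2 N" using b by (simp add: L2_orthonormal_basis_def)
      note [measurable] = L2_inner_borel_measurable[OF e sp se]
      have "L2_inner N (Q (\<eta> n)) U =
          (\<integral>X. (L2_inner N X (\<eta> n) - (\<integral>Y. L2_inner N Y (\<eta> n) \<partial>\<mu>)) * (L2_inner N X U - m) \<partial>\<mu>)"
        using Q e U mean by (simp add: L2_covariance_operator_def)
      also have "\<dots> = (\<integral>X. 0 \<partial>\<mu>)"
        by (intro integral_cong_AE) (use ae in \<open>auto\<close>)
      finally have "L2_inner N (Q (\<eta> n)) U = 0" by simp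
      moreover have "L2_inner N (Q (\<eta> n)) U = l n * L2_inner N (\<eta> n) U"
        using L2_inner_class[OF L2_fun_scaleR[OF rep_L2(2)[OF e], of "l n"] rep_L2(2)[OF U]]
          rep_L2(3)[OF U, symmetric]
        by (simp add: eig L2_scaleR_def) (simp add: L2_inner_def)
      ultimately show ?thesis using pos[of n] by (simp add: L2_inner_commute)
    qed
    then show False using L2_eq_zero_if_orthogonal_basis[OF b U] U0 by blast
  qed
  have "emeasure \<mu> {X \<in> L2 N. L2_inner N X U = 0}
      = emeasure (distr \<mu> borel (\<lambda>X. L2_inner N X U)) {0}"
    by (subst emeasure_distr) (auto simp: sp intro!: arg_cong[where f = "emeasure \<mu>"])
  also have "\<dots> = emeasure (density lborel (normal_density m \<sigma>)) {0}"
    using ms \<open>\<sigma> \<noteq> 0\<close> by (simp add: normal_law_def)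
  also have "\<dots> = 0"
  proof -
    have "{0} \<in> null_sets (lborel :: real measure)" by (rule finite_imp_null_set_lborel) simp
    then have "{0} \<in> null_sets (density lborel (normal_density m \<sigma>))"
      by (rule absolutely_continuousI_density[unfolded absolutely_continuous_def, THEN subsetD, rotated])
         measurable
    then show ?thesis by auto
  qed
  finally have "emeasure \<mu> {X \<in> L2 N. L2_inner N X U = 0} = 0" .
  moreover have "{X \<in> space \<mu>. L2_inner N X U = 0} \<in> sets \<mu>" by measurable
  ultimately show ?thesis by (simp add: null_sets_def sp)
qed

section \<open>Haar-type test processes and their orthogonality to Euler-Maruyama processes\<close>

text \<open>A predictable integrand has the same integral over the full product space, where Fubini
  applies. Inner products can then be computed path by path.\<close>

lemma integral_predictable_inner:
  assumes "brownian_motion M W" "0 < T" and X: "X \<in> L2_fun (predictable_measure M W T)"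
    and Y: "Y \<in> L2_fun (predictable_measure M W T)"
  shows "(\<integral>z. X z \<bullet> Y z \<partial>predictable_measure M W T) = (\<integral>\<omega>. (LBINT t:{0..T}. X (t, \<omega>) \<bullet> Y (t, \<omega>)) \<partial>M)"
proof -
  interpret brownian_motion M W by fact
  interpret L: sigma_finite_measure "restrict_space lborel {0..T}"
    by (rule sigma_finite_measure_restrict_space[OF lborel.sigma_finite_measure_axioms]) auto
  interpret P: pair_sigma_finite "restrict_space lborel {0..T}" M by standard
  let ?P = "restrict_space lborel {0..T} \<Otimes>\<^sub>M M"
  note sub = sets_predictable_algebra_le[OF assms(1,2)]
  have i: "integrable (predictable_measure M W T) (\<lambda>z. X z \<bullet> Y z)"
    by (rule L2_fun_integrable_inner[OF X Y])
  have "(\<integral>z. X z \<bullet> Y z \<partial>predictable_measure M W T) = (\<integral>z. X z \<bullet> Y z \<partial>?P)"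
    using i measurable_in_subalg'[OF sub] unfolding predictable_measure_def
    by (intro integral_subalgebra2[OF sub]) (auto dest: borel_measurable_integrable)
  also have "\<dots> = (\<integral>\<omega>. (\<integral>t. X (t, \<omega>) \<bullet> Y (t, \<omega>) \<partial>restrict_space lborel {0..T}) \<partial>M)"
  proof -
    have "integrable ?P (\<lambda>z. X z \<bullet> Y z)"
      using i integrable_from_subalg[OF sub] by (auto simp: predictable_measure_def)
    then show ?thesis
      using P.integral_snd[of "\<lambda>t \<omega>. X (t, \<omega>) \<bullet> Y (t, \<omega>)"] by (simp add: case_prod_unfold)
  qed
  also have "\<dots> = (\<integral>\<omega>. (LBINT t:{0..T}. X (t, \<omega>) \<bullet> Y (t, \<omega>)) \<partial>M)"
    by (simp add: set_lebesgue_integral_def integral_restrict_space)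
  finally show ?thesis .
qed

text \<open>An unnormalised Haar wavelet on \<open>(0, a]\<close>, deterministic and with the same
  value in every coordinate, since \<open>1\<close> is the all-ones vector. The intervals are open
  on the left to match the rectangles generating \<open>predictable_algebra\<close>.\<close>

definition haar_process :: "real \<Rightarrow> real \<times> 'w \<Rightarrow> real ^ 'd" where
  "haar_process a z = (indicator {0<..a/2} (fst z) - indicator {a/2<..a} (fst z)) *\<^sub>R 1"

text \<open>The process is bounded and the underlying measure is finite, so only predictability
  needs work. The bound \<open>a \<le> T\<close> keeps both intervals inside the time
  horizon.\<close>

lemma haar_process_L2_fun:
  assumes "brownian_motion M W" "0 < T" and a: "0 < a" "a \<le> T"
  shows "haar_process a \<in> L2_fun (predictable_measure M W T)"
proof -
  interpret brownian_motion M W by fact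
  interpret L: sigma_finite_measure "restrict_space lborel {0..T}"
    by (rule sigma_finite_measure_restrict_space[OF lborel.sigma_finite_measure_axioms]) auto
  let ?P = "restrict_space lborel {0..T} \<Otimes>\<^sub>M M"
  let ?F = "usual_augmentation M W"
  let ?G = "predictable_algebra M ?F T"
  let ?N = "predictable_measure M W T"
  note sub = sets_predictable_algebra_le[OF assms(1,2)]
  have "emeasure ?P (space ?P) = emeasure (restrict_space lborel {0..T}) {0..T} * emeasure M (space M)"
    unfolding space_pair_measure
    by (subst emeasure_pair_measure_Times) (auto simp: space_restrict_space sets_restrict_space_iff)
  also have "\<dots> < \<infinity>"
    using \<open>0 < T\<close> by (simp add: emeasure_restrict_space emeasure_space_1)
  finally have "finite_measure ?P" by (intro finite_measureI) auto
  then interpret N: finite_measure ?N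
    unfolding predictable_measure_def by (rule finite_measure_restr_to_subalg[OF sub])
  have N: "sets ?N = sets ?G" "space ?N = {0..T} \<times> space M"
    by (simp_all add: predictable_measure_def sets_restr_to_subalg[OF sub] space_restr_to_subalg
        space_pair_measure space_restrict_space)
  \<comment> \<open>A deterministic time interval corresponds to the generating rectangle whose
    event is the sure one.\<close>
  have gen: "{s<..t} \<times> space M \<in> sets ?N" if "0 \<le> s" "s < t" "t \<le> T" for s t
  proof -
    have aug: "space (?F r) = space M" for r
      unfolding usual_augmentation_def by (simp add: space_measure_of_conv)
    have sp: "A \<subseteq> space M" if "A \<in> sets (?F r)" for A r
      using sets.sets_into_space[OF that] by (simp add: aug)
    have *: "sets ?G = sigma_sets ({0..T} \<times> space M)
       ({{0} \<times> A | A. A \<in> sets (?F 0)} \<union>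
        {{s<..t} \<times> A | s t A. 0 \<le> s \<and> s < t \<and> t \<le> T \<and> A \<in> sets (?F s)})"
      unfolding predictable_algebra_def
      by (rule sets_measure_of) (use sp \<open>0 < T\<close> in fastforce)
    have "space M \<in> sets (?F s)"
      using sets.top[of "?F s"] by (simp add: aug)
    then show ?thesis
      unfolding N * using that by (intro sigma_sets.Basic) blast
  qed
  have ind: "(\<lambda>z. indicator {s<..t} (fst z) :: real) \<in> borel_measurable ?N"
    if "0 \<le> s" "s < t" "t \<le> T" for s t
  proof -
    have "(\<lambda>z. indicator ({s<..t} \<times> space M) z :: real) \<in> borel_measurable ?N"
      using gen[OF that] by simp
    also have "?this \<longleftrightarrow> ?thesis"
      by (rule measurable_cong) (auto simp: N indicator_def)
    finally show ?thesis .
  qed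
  have [measurable]: "(haar_process a :: _ \<Rightarrow> real ^ 'c) \<in> borel_measurable ?N"
    unfolding haar_process_def using a
    by (intro borel_measurable_scaleR borel_measurable_diff ind) auto
  have "norm (haar_process a z :: real ^ 'c) \<le> norm (1 :: real ^ 'c)" for z :: "real \<times> 'a"
    by (simp add: haar_process_def indicator_def)
  then have "norm ((norm (haar_process a z :: real ^ 'c))\<^sup>2) \<le> (norm (1 :: real ^ 'c))\<^sup>2" for z :: "real \<times> 'a"
    by simp
  then have "integrable ?N (\<lambda>z. (norm (haar_process a z :: real ^ 'c))\<^sup>2)"
    by (intro N.integrable_const_bound[where B = "(norm (1 :: real ^ 'c))\<^sup>2"] AE_I2) auto
  then show ?thesis by (simp add: L2_fun_def)
qed

lemma haar_process_norm_pos: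
  assumes "brownian_motion M W" "0 < T" and a: "0 < a" "a \<le> T"
  shows "L2_inner (predictable_measure M W T) (L2_class (predictable_measure M W T) (haar_process a))
    (L2_class (predictable_measure M W T) (haar_process a :: _ \<Rightarrow> real ^ 'd)) \<noteq> 0"
proof -
  interpret brownian_motion M W by fact
  let ?h = "haar_process a :: real \<times> 'a \<Rightarrow> real ^ 'd"
  note h = haar_process_L2_fun[OF assms, where ?'c = 'd]
  have "(LBINT t:{0..T}. ?h (t, \<omega>) \<bullet> ?h (t, \<omega>)) = a * (norm (1 :: real ^ 'd))\<^sup>2" for \<omega>
  proof -
    \<comment> \<open>The two halves are disjoint, so the square removes the sign and leaves the
      indicator of \<open>(0, a]\<close>.\<close>
    have "(LBINT t:{0..T}. ?h (t, \<omega>) \<bullet> ?h (t, \<omega>))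
        = (LBINT t. indicator {0<..a} t * (norm (1 :: real ^ 'd))\<^sup>2)"
      unfolding set_lebesgue_integral_def
      by (rule Bochner_Integration.integral_cong)
         (use a in \<open>auto simp: haar_process_def indicator_def dot_square_norm\<close>)
    also have "\<dots> = a * (norm (1 :: real ^ 'd))\<^sup>2" using a by simp
    finally show ?thesis .
  qed
  then show ?thesis
    unfolding L2_inner_class[OF h h] integral_predictable_inner[OF assms(1,2) h h]
    using a by (simp add: prob_space)
qed

text \<open>The mesh of the grid serves as \<open>\<delta>\<close>. Up to that time almost every
  path is constant, and the test process has time integral zero on \<open>(0, a]\<close>.\<close>

lemma EM_orthogonal_haar:
  fixes U :: "(real \<times> 'w \<Rightarrow> real ^ 'd) set"
  assumes BM: "brownian_motion M W" and T: "0 < T" and U: "U \<in> EM_processes M W T"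
  obtains \<delta> where "0 < \<delta>" "\<And>a. 0 < a \<Longrightarrow> a < \<delta> \<Longrightarrow> a \<le> T \<Longrightarrow>
    L2_inner (predictable_measure M W T) U (L2_class (predictable_measure M W T) (haar_process a)) = 0"
proof -
  let ?N = "predictable_measure M W T"
  obtain X X0 \<delta> f where U2: "U \<in> L2 ?N" and X: "X \<in> U" and \<delta>: "0 < \<delta>" "\<delta> < T"
    and eq: "AE \<omega> in M. \<forall>t\<in>{0..T}. X (t, \<omega>) =
        (\<Sum>i<nat \<lceil>T / \<delta>\<rceil>. indicator {grid T \<delta> i..<grid T \<delta> (Suc i)} t *\<^sub>R
           vec_cond_exp M (usual_augmentation M W (grid T \<delta> i)) (EM_step f W T \<delta> X0 i) \<omega>)"
    using U unfolding EM_processes_def H2_def by blast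
  define c where "c = vec_cond_exp M (usual_augmentation M W (grid T \<delta> 0)) (EM_step f W T \<delta> X0 0)"
  have const: "AE \<omega> in M. \<forall>t\<in>{0..<\<delta>}. X (t, \<omega>) = c \<omega>"
    using eq
  proof eventually_elim
    case (elim \<omega>)
    show ?case
    proof
      fix t assume t: "t \<in> {0..<\<delta>}"
      let ?s = "\<lambda>i. indicator {grid T \<delta> i..<grid T \<delta> (Suc i)} t *\<^sub>R
           vec_cond_exp M (usual_augmentation M W (grid T \<delta> i)) (EM_step f W T \<delta> X0 i) \<omega>"
      have "?s i = 0" if "i \<noteq> 0" for i
      proof -
        \<comment> \<open>Every grid point with positive index is at least \<open>\<delta>\<close>
          or equal to \<open>T\<close>, hence lies beyond \<open>t\<close>; only the summand with
          index 0 survives.\<close>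
        have "1 * \<delta> \<le> real i * \<delta>" using that \<delta> by (intro mult_right_mono) auto
        with t \<delta> have "t < real i * \<delta>" "t < T" unfolding mult_1 atLeastLessThan_iff by linarith+
        then have "t < grid T \<delta> i" by (simp add: grid_def)
        then show ?thesis by simp
      qed
      \<comment> \<open>Index 0 does occur in the range, because \<open>T / \<delta>\<close> is
        positive and its ceiling is at least 1.\<close>
      then have "(\<Sum>i<nat \<lceil>T / \<delta>\<rceil>. ?s i) = (\<Sum>i\<in>{0}. ?s i)"
        using \<delta> T by (intro sum.mono_neutral_right) auto
      \<comment> \<open>The first cell is exactly \<open>[0, \<delta>)\<close>, since
        \<open>\<delta> < T\<close> makes the minimum in \<open>grid T \<delta> 1\<close> equal to
        \<open>\<delta>\<close>.\<close>
      also have "\<dots> = c \<omega>"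
        using t \<delta> by (simp add: c_def grid_def)
      finally show "X (t, \<omega>) = c \<omega>" using elim t \<delta> by simp
    qed
  qed
  have XL: "X \<in> L2_fun ?N" "U = L2_class ?N X"
  proof -
    obtain g where g: "g \<in> L2_fun ?N" "U = L2_class ?N g" using U2 by (auto simp: L2_def)
    have "X \<in> L2_fun ?N" "AE z in ?N. g z = X z" using X g by (auto simp: L2_class_def)
    then show "X \<in> L2_fun ?N" "U = L2_class ?N X" using g(2) L2_class_cong[of g X ?N] by simp_all
  qed
  have "L2_inner ?N U (L2_class ?N (haar_process a)) = 0" if a: "0 < a" "a < \<delta>" "a \<le> T" for a
  proof -
    note h = haar_process_L2_fun[OF BM T a(1,3), where ?'c = 'd]
    have "AE \<omega> in M. (LBINT t:{0..T}. X (t, \<omega>) \<bullet> haar_process a (t, \<omega>)) = 0"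
      using const
    proof eventually_elim
      case (elim \<omega>)
      \<comment> \<open>Where \<open>X\<close> may differ from \<open>c \<omega>\<close>, at times
        from \<open>\<delta>\<close> on, the test process vanishes because
        \<open>a < \<delta>\<close>. The two remaining terms cancel, both halves having length
        \<open>a/2\<close>.\<close>
      have "(LBINT t:{0..T}. X (t, \<omega>) \<bullet> haar_process a (t, \<omega>))
          = (LBINT t. indicator {0<..a/2} t * (c \<omega> \<bullet> 1) - indicator {a/2<..a} t * (c \<omega> \<bullet> 1))"
        unfolding set_lebesgue_integral_def
        by (rule Bochner_Integration.integral_cong)
           (use a elim in \<open>auto simp: haar_process_def indicator_def\<close>)
      also have "\<dots> = 0" using a by simp
      finally show ?case .
    qed
    then show ?thesis
      unfolding XL(2) L2_inner_class[OF XL(1) h] integral_predictable_inner[OF BM T XL(1) h]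
      by (rule integral_eq_zero_AE)
  qed
  with \<delta>(1) show thesis by (rule that)
qed

section \<open>The countable cover by hyperplanes and both conclusions\<close>

theorem proposition4p5:
  fixes M :: "'w measure" and W :: "real \<Rightarrow> 'w \<Rightarrow> real ^ 'e" and T :: real
  assumes "complete_measure M" and "brownian_motion M W" and "0 < T"
  shows
    "(\<forall>(\<mu> :: (real \<times> 'w \<Rightarrow> real ^ 'd) set measure) Q \<eta> ev.
        L2_gaussian (predictable_measure M W T) \<mu> \<and>
        L2_centred (predictable_measure M W T) \<mu> \<and>
        L2_covariance_operator (predictable_measure M W T) \<mu> Q \<and>
        L2_orthonormal_basis (predictable_measure M W T) \<eta> \<and>
        (\<forall>n. 0 < ev n) \<and>
        (\<forall>n. Q (\<eta> n) = L2_scaleR (predictable_measure M W T) (ev n) (\<eta> n))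
        \<longrightarrow> EM_processes M W T \<in> null_sets (completion \<mu>)) \<and>
     meagre_in (L2_topology (predictable_measure M W T))
       (EM_processes M W T :: (real \<times> 'w \<Rightarrow> real ^ 'd) set set)"
proof -
  let ?N = "predictable_measure M W T"
  let ?EM = "EM_processes M W T :: (real \<times> 'w \<Rightarrow> real ^ 'd) set set"
  \<comment> \<open>A sequence in \<open>(0, T]\<close> tending to 0, so that for every mesh some
    \<open>a n\<close> is smaller; this turns the uncountable choice of \<open>\<delta>\<close> into
    a countable union.\<close>
  define a where "a n = T / real (Suc n)" for n
  define V where "V n = L2_class ?N (haar_process (a n) :: _ \<Rightarrow> real ^ 'd)" for n
  define H where "H n = {X \<in> L2 ?N. L2_inner ?N X (V n) = 0}" for n
  have a: "0 < a n" "a n \<le> T" for n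
    using \<open>0 < T\<close> by (simp_all add: a_def divide_le_eq)
  have V: "V n \<in> L2 ?N" "L2_inner ?N (V n) (V n) \<noteq> 0" for n
    unfolding V_def using haar_process_L2_fun[OF assms(2,3) a] haar_process_norm_pos[OF assms(2,3) a]
    by (auto simp: L2_def)
  have cover: "?EM \<subseteq> (\<Union>n. H n)"
  proof
    fix U assume U: "U \<in> ?EM"
    then have U2: "U \<in> L2 ?N" by (simp add: EM_processes_def H2_def)
    obtain \<delta> where \<delta>: "0 < \<delta>"
      "\<And>a. 0 < a \<Longrightarrow> a < \<delta> \<Longrightarrow> a \<le> T \<Longrightarrow> L2_inner ?N U (L2_class ?N (haar_process a)) = 0"
      using EM_orthogonal_haar[OF assms(2,3) U] by blast
    obtain n where "T / \<delta> < real n" using reals_Archimedean2 by blast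
    then have "T / \<delta> < real (Suc n)" by simp
    then have "a n < \<delta>" using \<delta>(1) by (simp add: a_def field_simps)
    then show "U \<in> (\<Union>n. H n)" using \<delta>(2)[OF a(1) _ a(2)] U2 by (auto simp: H_def V_def)
  qed
  show ?thesis
  proof (intro conjI allI impI)
    fix \<mu> :: "(real \<times> 'w \<Rightarrow> real ^ 'd) set measure" and Q \<eta> ev
    assume *: "L2_gaussian ?N \<mu> \<and> L2_centred ?N \<mu> \<and> L2_covariance_operator ?N \<mu> Q \<and>
        L2_orthonormal_basis ?N \<eta> \<and> (\<forall>n. 0 < ev n) \<and> (\<forall>n. Q (\<eta> n) = L2_scaleR ?N (ev n) (\<eta> n))"
    have "H n \<in> null_sets \<mu>" for n
      unfolding H_def by (rule L2_gaussian_hyperplane_null[of _ _ Q \<eta> ev]) (use * V in auto)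
    then have "(\<Union>n. H n) \<in> null_sets \<mu>" by (rule null_sets_UN)
    \<comment> \<open>The argument encloses the class in a Borel null set without showing the class
      itself to be Borel; in the completion, every subset of a null set is null.\<close>
    then show "?EM \<in> null_sets (completion \<mu>)"
      using cover null_sets_completion_iff2 by blast
  next
    show "meagre_in (L2_topology ?N) ?EM"
      unfolding meagre_in_def
      using cover nowhere_dense_hyperplane[OF V] by (intro exI[of _ "range H"]) (auto simp: H_def)
  qed
qed

end
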